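(* Let $A\in\mathbb{K}_k^{n\times n}$ be such that each block $\hat A_j$ ($j=1,\dots,k$) of $\mathrm{cft}(A)$ has simple eigenvalues, and let $m_j$ be the number of distinct eigenvalues of $\hat A_j$. Then the number of distinct eigenvalues $\lambda\in\mathbb{K}_k$ of $A$ (i.e. solutions of $\det(A-\lambda\circ I)=0$) is $\prod_{j=1}^k m_j$, and the number of distinct eigenvectors of $A$, up to normalization, is also $\prod_{j=1}^k m_j$. Consequently $A$ has at most $n^k$ eigenvalues when $\lambda\in\mathbb{K}_k$ is allowed to be complex-valued; and if $A$ is real-valued, then $A$ has at most $n^{\lceil (k+1)/2\rceil}$ real-valued eigenvalues.
   Context: Circulant algebra. $\mathbb{K}_k$ is the commutative ring of length-$k$ parameter tuples $\alpha=\{\alpha_1,\dots,\alpha_k\}$ (complex entries allowed), identified with the $k\times k$ circulant matrix $\mathrm{circ}(\alpha)$ whose first column is $(\alpha_1,\dots,\alpha_k)^T$; sum and product ($\circ$) are those of the circulant matrices. $\mathbb{K}_k^n$ and $\mathbb{K}_k^{m\times n}$ are vectors and matrices over this ring, with the usual matrix product, also written $\circ$. An element of $\mathbb{K}_k$, or a vector or matrix over it, is real-valued if all its parameters are real. Fourier coefficients. Let $F$ be the $k\times k$ unitary matrix with $F_{ij}=\omega^{(i-1)(j-1)}/\sqrt{k}$, $\omega=e^{2\pi \mathrm{i}/k}$. Put $\mathrm{cft}(\alpha)=F^*\mathrm{circ}(\alpha)F=\mathrm{diag}(\hat\alpha_1,\dots,\hat\alpha_k)$. For $A\in\mathbb{K}_k^{n\times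 n}$, $\mathrm{cft}(A)$ is the block-diagonal matrix with blocks $\hat A_1,\dots,\hat A_k\in\mathbb{C}^{n\times n}$, where the $(r,s)$ entry of $\hat A_j$ is the $j$-th diagonal entry of $\mathrm{cft}(A_{r,s})$; similarly $x\in\mathbb{K}_k^n$ has blocks $\hat x_1,\dots,\hat x_k\in\mathbb{C}^n$. Eigenpairs. $\lambda\in\mathbb{K}_k$ is an eigenvalue of $A$ if $\det(A-\lambda\circ I)=0$ in $\mathbb{K}_k$. An eigenvector is $x\in\mathbb{K}_k^n$ with $\hat x_j\neq0$ for all $j$ and $A\circ x=\lambda\circ x$ for some eigenvalue $\lambda$. "Up to normalization" means up to multiplication by an invertible element of $\mathbb{K}_k$. *)

theory Defs
  imports
    "HOL-Library.Cardinality"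
    "Jordan_Normal_Form.Spectral_Radius"
begin

text \<open>
  The length \<open>k \<ge> 1\<close> of the parameter tuples is \<open>CARD('k)\<close>; nothing else about \<open>'k\<close> matters.
  It is a type parameter so that the tuples form a type of class \<open>comm_ring_1\<close>, over which
  determinants and matrix products are available; the size \<open>n\<close> of matrices stays a natural number.
  Indices start at \<open>0\<close>: \<open>\<alpha>\<^sub>1, \<dots>, \<alpha>\<^sub>k\<close> are \<open>params \<alpha> $ 0, \<dots>, params \<alpha> $ (k - 1)\<close>, and likewise for the
  diagonal entries of \<open>cft\<close> and for the blocks.
\<close>

typedef ('k::finite) circulant = "carrier_vec CARD('k) :: complex vec set"
  morphisms params circulant_of
  by (rule exI[of _ "0\<^sub>v CARD('k)"]) simp

text \<open>Entry \<open>(i, j)\<close> is the parameter at \<open>i - j\<close> modulo \<open>k\<close>; adding \<open>k\<close> keeps the subtraction on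
  natural numbers from truncating.\<close>

definition circ :: "'k::finite circulant \<Rightarrow> complex mat" where
  "circ \<alpha> = mat CARD('k) CARD('k) (\<lambda>(i, j). params \<alpha> $ ((i + CARD('k) - j) mod CARD('k)))"

definition of_circ :: "complex mat \<Rightarrow> 'k::finite circulant" where
  "of_circ M = circulant_of (col M 0)"

lemma dim_params [simp]: "dim_vec (params (\<alpha> :: 'k::finite circulant)) = CARD('k)"
  using params[of \<alpha>] by auto

lemma circ_carrier [simp]: "circ (\<alpha> :: 'k::finite circulant) \<in> carrier_mat CARD('k) CARD('k)"
  by (simp add: circ_def)

lemma dim_circ [simp]:
  "dim_row (circ (\<alpha> :: 'k::finite circulant)) = CARD('k)"
  "dim_col (circ (\<alpha> :: 'k::finite circulant)) = CARD('k)"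
  by (simp_all add: circ_def)

lemma index_circ:
  "i < CARD('k) \<Longrightarrow> j < CARD('k) \<Longrightarrow>
    circ (\<alpha> :: 'k::finite circulant) $$ (i, j) = params \<alpha> $ ((i + CARD('k) - j) mod CARD('k))"
  by (simp add: circ_def)

lemma col_circ_0: "col (circ \<alpha>) 0 = params (\<alpha> :: 'k::finite circulant)"
  by (rule eq_vecI) (simp_all add: index_circ)

lemma of_circ_circ [simp]: "of_circ (circ \<alpha>) = (\<alpha> :: 'k::finite circulant)"
  by (simp add: of_circ_def col_circ_0 params_inverse)

lemma circ_inject: "circ \<alpha> = circ \<beta> \<longleftrightarrow> \<alpha> = (\<beta> :: 'k::finite circulant)"
proof
  assume "circ \<alpha> = circ \<beta>"
  then have "(of_circ (circ \<alpha>) :: 'k circulant) = of_circ (circ \<beta>)" by (rule arg_cong)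
  then show "\<alpha> = \<beta>" by (simp only: of_circ_circ)
qed (rule arg_cong)

lemma circ_of_circ:
  assumes "M \<in> carrier_mat CARD('k) CARD('k)"
    and "\<And>i j. i < CARD('k) \<Longrightarrow> j < CARD('k) \<Longrightarrow>
      M $$ (i, j) = M $$ ((i + CARD('k) - j) mod CARD('k), 0)"
  shows "circ (of_circ M :: 'k::finite circulant) = M"
proof (rule eq_matI)
  have dim: "dim_row M = CARD('k)" "dim_col M = CARD('k)"
    using assms(1) by simp_all
  have inv: "params (of_circ M :: 'k circulant) = col M 0"
    unfolding of_circ_def
  proof (rule circulant_of_inverse)
    show "col M 0 \<in> carrier_vec CARD('k)"
      by (rule carrier_vecI) (simp only: dim_col dim)
  qed
  fix i j assume "i < dim_row M" "j < dim_col M"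
  then have ij: "i < CARD('k)" "j < CARD('k)" by (simp_all add: dim)
  have "circ (of_circ M :: 'k circulant) $$ (i, j) = col M 0 $ ((i + CARD('k) - j) mod CARD('k))"
    by (simp only: index_circ[OF ij] inv)
  also have "\<dots> = M $$ ((i + CARD('k) - j) mod CARD('k), 0)"
    by (rule index_col) (simp_all add: dim)
  also have "\<dots> = M $$ (i, j)"
    by (rule assms(2)[OF ij, symmetric])
  finally show "circ (of_circ M :: 'k circulant) $$ (i, j) = M $$ (i, j)" .
next
  show "dim_row (circ (of_circ M :: 'k circulant)) = dim_row M"
    and "dim_col (circ (of_circ M :: 'k circulant)) = dim_col M"
    using assms(1) by simp_all
qed

instantiation circulant :: (finite) "{zero, one, plus, minus, uminus, times}"
begin
definition zero_circulant :: "'a circulant" where "0 = of_circ (0\<^sub>m CARD('a) CARD('a))"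
definition one_circulant :: "'a circulant" where "1 = of_circ (1\<^sub>m CARD('a))"
definition plus_circulant :: "'a circulant \<Rightarrow> 'a circulant \<Rightarrow> 'a circulant"
  where "\<alpha> + \<beta> = of_circ (circ \<alpha> + circ \<beta>)"
definition minus_circulant :: "'a circulant \<Rightarrow> 'a circulant \<Rightarrow> 'a circulant"
  where "\<alpha> - \<beta> = of_circ (circ \<alpha> - circ \<beta>)"
definition uminus_circulant :: "'a circulant \<Rightarrow> 'a circulant"
  where "- \<alpha> = of_circ (- circ \<alpha>)"
definition times_circulant :: "'a circulant \<Rightarrow> 'a circulant \<Rightarrow> 'a circulant"
  where "\<alpha> * \<beta> = of_circ (circ \<alpha> * circ \<beta>)"
instance ..
end

lemma mod_shift_eq_0:
  fixes i j k :: nat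
  assumes "i < k" "j < k"
  shows "(i + k - j) mod k = 0 \<longleftrightarrow> i = j"
proof (cases "j \<le> i")
  case True
  then have "i + k - j = (i - j) + k" by simp
  then have "(i + k - j) mod k = (i - j) mod k" by (simp only: mod_add_self2)
  also have "\<dots> = i - j" using assms by (intro mod_less) simp
  finally have "(i + k - j) mod k = i - j" .
  then show ?thesis using True by auto
next
  case False
  then have "(i + k - j) mod k = i + k - j" using assms by (intro mod_less) auto
  then show ?thesis using False assms by auto
qed

lemma circ_zero: "circ (0 :: 'k::finite circulant) = 0\<^sub>m CARD('k) CARD('k)"
  unfolding zero_circulant_def by (rule circ_of_circ) auto

lemma circ_one: "circ (1 :: 'k::finite circulant) = 1\<^sub>m CARD('k)"
  unfolding one_circulant_def by (rule circ_of_circ) (auto simp: mod_shift_eq_0)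

lemma circ_plus: "circ (\<alpha> + \<beta> :: 'k::finite circulant) = circ \<alpha> + circ \<beta>"
  unfolding plus_circulant_def by (rule circ_of_circ) (auto simp: index_circ)

lemma circ_minus: "circ (\<alpha> - \<beta> :: 'k::finite circulant) = circ \<alpha> - circ \<beta>"
  unfolding minus_circulant_def by (rule circ_of_circ) (auto simp: index_circ minus_mat_def)

lemma circ_uminus: "circ (- \<alpha> :: 'k::finite circulant) = - circ \<alpha>"
  unfolding uminus_circulant_def by (rule circ_of_circ) (auto simp: index_circ)

lemma mod_shift:
  fixes i j k :: nat
  assumes "j < k"
  shows "int ((i + k - j) mod k) = (int i - int j) mod int k"
proof -
  have "int (i + k - j) = (int i - int j) + int k" using assms by auto
  then show ?thesis by (simp add: zmod_int del: of_nat_diff)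
qed

lemma index_circ_mult:
  fixes \<alpha> \<beta> :: "'k::finite circulant"
  assumes "i < CARD('k)" "j < CARD('k)"
  shows "(circ \<alpha> * circ \<beta>) $$ (i, j) =
    (\<Sum>l<CARD('k). params \<alpha> $ ((i + CARD('k) - l) mod CARD('k)) *
      params \<beta> $ ((l + CARD('k) - j) mod CARD('k)))"
  using assms by (simp add: scalar_prod_def index_circ lessThan_atLeast0)

lemma circ_mult_shift:
  fixes \<alpha> \<beta> :: "'k::finite circulant"
  assumes ij: "i < CARD('k)" "j < CARD('k)"
  shows "(circ \<alpha> * circ \<beta>) $$ (i, j) =
    (\<Sum>l<CARD('k). params \<alpha> $ (((i + CARD('k) - j) mod CARD('k) + CARD('k) - l) mod CARD('k)) *
      params \<beta> $ l)"
proof -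
  let ?k = "CARD('k)"
  let ?g = "\<lambda>l. (l + ?k - j) mod ?k"
  have bij: "bij_betw ?g {..<?k} {..<?k}"
  proof (rule bij_betw_byWitness[of _ "\<lambda>l. (l + j) mod ?k"])
    show "\<forall>a\<in>{..<?k}. (?g a + j) mod ?k = a"
    proof
      fix a assume a: "a \<in> {..<?k}"
      have "int ((?g a + j) mod ?k) = int a"
        using a ij by (simp add: mod_shift zmod_int mod_add_left_eq del: of_nat_diff)
      then show "(?g a + j) mod ?k = a" by simp
    qed
    show "\<forall>a\<in>{..<?k}. ?g ((a + j) mod ?k) = a"
    proof
      fix a assume a: "a \<in> {..<?k}"
      have "int (?g ((a + j) mod ?k)) = (int ((a + j) mod ?k) - int j) mod int ?k"
        by (rule mod_shift[OF ij(2)])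
      also have "\<dots> = int a"
        using a by (simp add: zmod_int mod_diff_left_eq)
      finally have "int (?g ((a + j) mod ?k)) = int a" .
      then show "?g ((a + j) mod ?k) = a" by simp
    qed
  qed auto
  have "(((i + ?k - j) mod ?k) + ?k - ?g l) mod ?k = (i + ?k - l) mod ?k" if "l < ?k" for l
  proof -
    have "int ((((i + ?k - j) mod ?k) + ?k - ?g l) mod ?k) = int ((i + ?k - l) mod ?k)"
      using that ij by (simp add: mod_shift mod_diff_eq)
    then show ?thesis by simp
  qed
  then have "(circ \<alpha> * circ \<beta>) $$ (i, j) = (\<Sum>l<?k.
      params \<alpha> $ ((((i + ?k - j) mod ?k) + ?k - ?g l) mod ?k) * params \<beta> $ ?g l)"
    unfolding index_circ_mult[OF ij] by (intro sum.cong) auto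
  also have "\<dots> = (\<Sum>l<?k.
      params \<alpha> $ ((((i + ?k - j) mod ?k) + ?k - l) mod ?k) * params \<beta> $ l)"
    by (rule sum.reindex_bij_betw[OF bij])
  finally show ?thesis .
qed

lemma circ_times: "circ (\<alpha> * \<beta> :: 'k::finite circulant) = circ \<alpha> * circ \<beta>"
  unfolding times_circulant_def
proof (rule circ_of_circ)
  fix i j assume ij: "i < CARD('k)" "j < CARD('k)"
  show "(circ \<alpha> * circ \<beta>) $$ (i, j) =
      (circ \<alpha> * circ \<beta>) $$ ((i + CARD('k) - j) mod CARD('k), 0)"
    using ij by (simp add: circ_mult_shift del: index_mult_mat)
qed auto

lemma circ_mult_commute:
  fixes \<alpha> \<beta> :: "'k::finite circulant"
  shows "circ \<alpha> * circ \<beta> = circ \<beta> * circ \<alpha>"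
proof (rule eq_matI)
  let ?k = "CARD('k)"
  fix i j assume "i < dim_row (circ \<beta> * circ \<alpha>)" "j < dim_col (circ \<beta> * circ \<alpha>)"
  then have ij: "i < ?k" "j < ?k" by auto
  let ?g = "\<lambda>l. (i + j + ?k - l) mod ?k"
  have gg: "?g (?g l) = l" if "l < ?k" for l
  proof -
    have a: "int (?g l) = (int (i + j) - int l) mod int ?k"
      using mod_shift[of l ?k "i + j"] that by simp
    have "int (?g (?g l)) = (int (i + j) - int (?g l)) mod int ?k"
      by (rule mod_shift) simp
    also have "\<dots> = int l" unfolding a using that by (simp add: mod_diff_right_eq)
    finally show ?thesis by simp
  qed
  have bij: "bij_betw ?g {..<?k} {..<?k}"
    by (rule bij_betw_byWitness[of _ ?g]) (auto simp: gg)
  have 1: "(i + ?k - ?g l) mod ?k = (l + ?k - j) mod ?k"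
    and 2: "(?g l + ?k - j) mod ?k = (i + ?k - l) mod ?k" if "l < ?k" for l
  proof -
    have a: "int (?g l) = (int (i + j) - int l) mod int ?k"
      using mod_shift[of l ?k "i + j"] that by simp
    have "int ((i + ?k - ?g l) mod ?k) = (int i - int (?g l)) mod int ?k"
      by (rule mod_shift) simp
    also have "\<dots> = (int l - int j) mod int ?k"
      unfolding a by (simp add: mod_diff_right_eq)
    also have "\<dots> = int ((l + ?k - j) mod ?k)" using ij by (simp add: mod_shift)
    finally show "(i + ?k - ?g l) mod ?k = (l + ?k - j) mod ?k" by simp
    have "int ((?g l + ?k - j) mod ?k) = (int (?g l) - int j) mod int ?k"
      by (rule mod_shift) (use ij in simp)
    also have "\<dots> = (int i - int l) mod int ?k"
      unfolding a by (simp add: mod_diff_left_eq)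
    also have "\<dots> = int ((i + ?k - l) mod ?k)" using that by (simp add: mod_shift)
    finally show "(?g l + ?k - j) mod ?k = (i + ?k - l) mod ?k" by simp
  qed
  have "(circ \<alpha> * circ \<beta>) $$ (i, j) =
      (\<Sum>l<?k. params \<alpha> $ ((i + ?k - ?g l) mod ?k) * params \<beta> $ ((?g l + ?k - j) mod ?k))"
    unfolding index_circ_mult[OF ij] by (rule sum.reindex_bij_betw[OF bij, symmetric])
  also have "\<dots> = (circ \<beta> * circ \<alpha>) $$ (i, j)"
    unfolding index_circ_mult[OF ij] by (intro sum.cong) (auto simp: 1 2 mult.commute)
  finally show "(circ \<alpha> * circ \<beta>) $$ (i, j) = (circ \<beta> * circ \<alpha>) $$ (i, j)" .
qed auto

lemmas circ_hom = circ_zero circ_one circ_plus circ_minus circ_uminus circ_times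

instance circulant :: (finite) comm_ring_1
proof
  fix a b c :: "'a circulant"
  note eq = circ_inject[symmetric] circ_hom
  note C = circ_carrier[where 'k = 'a]
  show "a * b * c = a * (b * c)" unfolding eq by (rule assoc_mult_mat[OF C C C])
  show "a * b = b * a" unfolding eq by (rule circ_mult_commute)
  show "1 * a = a" unfolding eq by (rule left_mult_one_mat[OF C])
  show "a + b + c = a + (b + c)" unfolding eq by (rule assoc_add_mat[OF C C C])
  show "a + b = b + a" unfolding eq by (rule comm_add_mat[OF C C])
  show "0 + a = a" unfolding eq by (rule left_add_zero_mat[OF C])
  show "- a + a = 0" unfolding eq by (rule uminus_l_inv_mat[OF C])
  show "a - b = a + - b" unfolding eq by (rule add_uminus_minus_mat[OF C C, symmetric])
  show "(a + b) * c = a * c + b * c" unfolding eq by (rule add_mult_distrib_mat[OF C C C])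
  have "(0\<^sub>m CARD('a) CARD('a) :: complex mat) $$ (0, 0) \<noteq> 1\<^sub>m CARD('a) $$ (0, 0)" by simp
  then show "(0 :: 'a circulant) \<noteq> 1" unfolding eq by metis
qed

definition fourier_mat :: "nat \<Rightarrow> complex mat" where
  "fourier_mat k =
    mat k k (\<lambda>(i, j). exp (2 * of_real pi * \<i> / of_nat k) ^ (i * j) / of_real (sqrt (real k)))"

definition cft :: "'k::finite circulant \<Rightarrow> complex mat" where
  "cft \<alpha> = mat_adjoint (fourier_mat CARD('k)) * circ \<alpha> * fourier_mat CARD('k)"

definition fourier_coeff :: "nat \<Rightarrow> 'k::finite circulant \<Rightarrow> complex" where
  "fourier_coeff j \<alpha> = cft \<alpha> $$ (j, j)"

definition mat_block :: "nat \<Rightarrow> 'k::finite circulant mat \<Rightarrow> complex mat" where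
  "mat_block j A = map_mat (fourier_coeff j) A"

definition vec_block :: "nat \<Rightarrow> 'k::finite circulant vec \<Rightarrow> complex vec" where
  "vec_block j x = map_vec (fourier_coeff j) x"

definition has_simple_eigenvalues :: "complex mat \<Rightarrow> bool" where
  "has_simple_eigenvalues M \<longleftrightarrow> (\<forall>\<mu>. eigenvalue M \<mu> \<longrightarrow> order \<mu> (char_poly M) = 1)"

text \<open>
  The library's \<open>eigenvalue\<close> and \<open>eigenvector\<close> at type \<open>'k circulant\<close> would be different notions:
  there an eigenvector only has to be nonzero, here all its blocks have to be.
\<close>

definition circ_eigenvalue :: "'k::finite circulant mat \<Rightarrow> 'k circulant \<Rightarrow> bool" where
  "circ_eigenvalue A \<mu> \<longleftrightarrow> det (A - \<mu> \<cdot>\<^sub>m 1\<^sub>m (dim_row A)) = 0"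

definition circ_eigenvector :: "'k::finite circulant mat \<Rightarrow> 'k circulant vec \<Rightarrow> bool" where
  "circ_eigenvector A x \<longleftrightarrow>
    x \<in> carrier_vec (dim_row A) \<and>
    (\<forall>j < CARD('k). vec_block j x \<noteq> 0\<^sub>v (dim_row A)) \<and>
    (\<exists>\<mu>. circ_eigenvalue A \<mu> \<and> A *\<^sub>v x = \<mu> \<cdot>\<^sub>v x)"

definition same_up_to_normalization ::
    "'k::finite circulant mat \<Rightarrow> ('k circulant vec \<times> 'k circulant vec) set" where
  "same_up_to_normalization A =
    {(x, y). circ_eigenvector A x \<and> circ_eigenvector A y \<and> (\<exists>u. u dvd 1 \<and> y = u \<cdot>\<^sub>v x)}"

definition real_valued :: "'k::finite circulant \<Rightarrow> bool" where
  "real_valued \<alpha> \<longleftrightarrow> (\<forall>i < CARD('k). params \<alpha> $ i \<in> \<real>)"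

definition real_valued_mat :: "'k::finite circulant mat \<Rightarrow> bool" where
  "real_valued_mat A \<longleftrightarrow> (\<forall>r < dim_row A. \<forall>s < dim_col A. real_valued (A $$ (r, s)))"

end

theory Submission
  imports Defs
begin

text \<open>
  The discrete Fourier transform is a ring isomorphism from the circulants onto \<open>\<complex>\<^sup>k\<close> with
  componentwise operations, so an eigenpair of \<open>A\<close> is an independent choice of one eigenpair
  for each block. Simplicity makes the eigenvector of a block unique up to a nonzero scalar, and a
  tuple of \<open>k\<close> nonzero scalars is a unit, so eigenvector classes correspond to eigenvalues.
  Coefficients \<open>j\<close> and \<open>k - j\<close> of a real-valued circulant are conjugate, so a real-valued
  eigenvalue is determined by its first \<open>\<lfloor>k / 2\<rfloor> + 1 = \<lceil>(k + 1) / 2\<rceil>\<close> coefficients.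
\<close>

section \<open>Fourier coefficients\<close>

text \<open>The base of the powers in \<open>fourier_mat\<close>, written with \<open>cis\<close> so
  that De Moivre's formula and conjugation are directly available.\<close>

definition unity_root :: "nat \<Rightarrow> complex" where
  "unity_root k = cis (2 * pi / real k)"

lemma unity_root_power_self:
  assumes "k > 0"
  shows "unity_root k ^ k = 1"
  using assms by (simp add: unity_root_def DeMoivre)

lemma unity_root_power_inject:
  assumes "l < k" "m < k" "unity_root k ^ l = unity_root k ^ m"
  shows "l = m"
proof -
  have pow: "unity_root k ^ i = cis (2 * pi * real i / real k)" for i
    by (simp add: unity_root_def DeMoivre mult_ac)
  have "inj_on (\<lambda>i. cis (2 * pi * real i / real k)) {..<k}"
    using bij_betw_roots_unity[of k] assms(1) by (auto simp: bij_betw_def)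
  then show ?thesis
    using assms by (auto simp: pow dest: inj_onD)
qed

lemma cnj_unity_root_power_self:
  assumes "k > 0"
  shows "cnj (unity_root k) ^ k = 1"
  by (metis assms complex_cnj_one complex_cnj_power unity_root_power_self)

lemma unity_root_power_mult_cnj [simp]: "unity_root k ^ l * cnj (unity_root k) ^ l = 1"
  by (simp add: unity_root_def cis_cnj cis_mult flip: power_mult_distrib)

text \<open>A geometric sum whose ratio is a \<open>k\<close>-th root of unity: it vanishes unless
  the ratio is 1, which forces \<open>l = m\<close>.\<close>

lemma unity_root_orthogonal:
  assumes "l < k" "m < k"
  shows "(\<Sum>j<k. (unity_root k ^ l * cnj (unity_root k) ^ m) ^ j) = (if l = m then of_nat k else 0)"
proof (cases "l = m")
  case False
  define z where "z = unity_root k ^ l * cnj (unity_root k) ^ m"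
  have k: "k > 0" using assms by simp
  have "z ^ k = (unity_root k ^ k) ^ l * (cnj (unity_root k) ^ k) ^ m"
    by (simp only: z_def power_mult_distrib mult.commute flip: power_mult)
  then have "z ^ k = 1"
    by (simp only: unity_root_power_self[OF k] cnj_unity_root_power_self[OF k] power_one mult_1)
  moreover have "z \<noteq> 1"
  proof
    assume "z = 1"
    \<comment> \<open>Multiplying \<open>z = 1\<close> by \<open>unity_root k ^ m\<close> cancels
      the conjugate power and leaves an equality of two powers of the root.\<close>
    then have "unity_root k ^ m = unity_root k ^ l * (unity_root k ^ m * cnj (unity_root k) ^ m)"
      by (metis z_def mult.left_commute mult.right_neutral)
    then show False
      using unity_root_power_inject[of l k m] assms False by simp
  qed
  ultimately show ?thesis
    using False by (simp add: geometric_sum flip: z_def)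
qed simp

text \<open>Exponents of \<open>w\<close> matter only modulo \<open>k\<close>, so a cyclic shift by
  \<open>l\<close> pulls out the factor \<open>w ^ l\<close>. This yields both the diagonal of
  \<open>cft\<close> and the multiplicativity of its entries.\<close>

lemma sum_shift_mult_power:
  fixes w :: "'a::comm_semiring_1"
  assumes "l < k" "w ^ k = 1"
  shows "(\<Sum>a<k. f ((a + k - l) mod k) * w ^ a) = w ^ l * (\<Sum>a<k. f a * w ^ a)"
proof -
  have per: "w ^ (m mod k) = w ^ m" for m
    using assms(2) by (metis div_mult_mod_eq mult.commute mult_1 power_add power_mult power_one)
  have shift: "w ^ a = w ^ l * w ^ ((a + k - l) mod k)" for a
  proof -
    have "w ^ l * w ^ ((a + k - l) mod k) = w ^ (l + (a + k - l))"
      by (simp add: per power_add)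
    also have "\<dots> = w ^ (a + k)"
      using assms(1) by (intro arg_cong[where f = "(^) w"]) simp
    finally show ?thesis by (simp add: power_add assms(2))
  qed
  have "(\<Sum>a<k. f ((a + k - l) mod k) * w ^ ((a + k - l) mod k)) = (\<Sum>a<k. f a * w ^ a)"
  proof (rule sum.reindex_bij_witness[of _ "\<lambda>a. (a + l) mod k" "\<lambda>a. (a + k - l) mod k"])
    fix a assume a: "a \<in> {..<k}"
    have "((a + k - l) mod k + l) mod k = (a + k - l + l) mod k" by (rule mod_add_left_eq)
    then show "((a + k - l) mod k + l) mod k = a" using a assms(1) by simp
    show "((a + l) mod k + k - l) mod k = a"
    proof (cases "a + l < k")
      case False
      then have "(a + l) mod k = a + l - k" using a assms(1) by (simp add: mod_if)
      then show ?thesis using a False by simp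
    qed simp
  qed (use assms(1) in auto)
  moreover have "(\<Sum>a<k. f ((a + k - l) mod k) * w ^ a) =
      (\<Sum>a<k. w ^ l * (f ((a + k - l) mod k) * w ^ ((a + k - l) mod k)))"
    by (intro sum.cong refl, subst shift) (rule mult.left_commute)
  ultimately show ?thesis
    by (simp only: flip: sum_distrib_left)
qed

text \<open>The ring operations are known through \<open>circ\<close>, so the parameters of sums and
  products are read off its first column.\<close>

lemma params_eq_index_circ:
  "i < CARD('k) \<Longrightarrow> params (\<alpha> :: 'k::finite circulant) $ i = circ \<alpha> $$ (i, 0)"
  by (simp add: index_circ)

text \<open>Row \<open>j\<close> of the adjoint Fourier matrix is a left eigenvector of every
  circulant matrix, and this sum is the eigenvalue.\<close>

lemma fourier_coeff_eq:
  fixes \<alpha> :: "'k::finite circulant"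
  assumes j: "j < CARD('k)"
  shows "fourier_coeff j \<alpha> = (\<Sum>l<CARD('k). params \<alpha> $ l * (cnj (unity_root CARD('k)) ^ j) ^ l)"
proof -
  let ?k = "CARD('k)"
  let ?u = "unity_root ?k"
  let ?S = "\<Sum>l<?k. params \<alpha> $ l * (cnj ?u ^ j) ^ l"
  have u: "exp (2 * of_real pi * \<i> / of_nat ?k) = ?u"
    by (simp add: unity_root_def cis_conv_exp mult_ac)
  have F: "fourier_mat ?k $$ (a, b) = ?u ^ (a * b) / of_real (sqrt (real ?k))"
    if "a < ?k" "b < ?k" for a b
    using that unfolding fourier_mat_def u by simp
  have dimF: "dim_row (fourier_mat ?k) = ?k" "dim_col (fourier_mat ?k) = ?k"
    by (simp_all add: fourier_mat_def)
  have adj: "mat_adjoint (fourier_mat ?k) $$ (a, b) = cnj (fourier_mat ?k $$ (b, a))"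
    if "a < ?k" "b < ?k" for a b
    using that by (simp add: mat_adjoint_def mat_of_rows_def dimF conjugate_complex_def)
  have dimA: "dim_row (mat_adjoint (fourier_mat ?k)) = ?k" "dim_col (mat_adjoint (fourier_mat ?k)) = ?k"
    by (simp_all add: mat_adjoint_def dimF)
  have pow1: "(cnj ?u ^ j) ^ ?k = 1"
    by (metis cnj_unity_root_power_self mult.commute power_mult power_one zero_less_card_finite)
  have sq: "of_real (sqrt (real ?k)) * of_real (sqrt (real ?k)) = (of_nat ?k :: complex)"
    by (simp flip: of_real_mult)
  have "fourier_coeff j \<alpha> = (\<Sum>b<?k. (\<Sum>a<?k. cnj (fourier_mat ?k $$ (a, j)) *
      params \<alpha> $ ((a + ?k - b) mod ?k)) * fourier_mat ?k $$ (b, j))"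
    using j by (simp add: fourier_coeff_def cft_def scalar_prod_def dimF dimA adj index_circ
        lessThan_atLeast0)
  \<comment> \<open>The two normalizing factors \<open>sqrt k\<close> combine to the denominator
    \<open>k\<close>.\<close>
  also have "\<dots> = (\<Sum>b<?k. (\<Sum>a<?k. params \<alpha> $ ((a + ?k - b) mod ?k) * (cnj ?u ^ j) ^ a) *
      ?u ^ (b * j) / of_nat ?k)"
    using j by (intro sum.cong refl)
      (simp add: F sum_distrib_left sum_distrib_right sum_divide_distrib mult_ac flip: power_mult sq)
  also have "\<dots> = (\<Sum>b<?k. ((cnj ?u ^ j) ^ b * ?S) * ?u ^ (b * j) / of_nat ?k)"
    using pow1 by (intro sum.cong refl) (simp add: sum_shift_mult_power)
  \<comment> \<open>The shift factor cancels against the entry of the Fourier matrix, so all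
    \<open>k\<close> summands are equal.\<close>
  also have "\<dots> = (\<Sum>b<?k. ?S / of_nat ?k)"
  proof (intro sum.cong refl)
    fix b
    have "((cnj ?u ^ j) ^ b * ?S) * ?u ^ (b * j) = (?u ^ (b * j) * cnj ?u ^ (b * j)) * ?S"
      by (simp only: mult_ac flip: power_mult)
    then show "((cnj ?u ^ j) ^ b * ?S) * ?u ^ (b * j) / of_nat ?k = ?S / of_nat ?k"
      by simp
  qed
  finally show ?thesis by simp
qed

text \<open>The product of circulants is cyclic convolution. After exchanging the sums, each inner
  sum is a shifted coefficient sum of the first factor, and the shift factor passes to the second.
  The locale form lets coefficients commute with \<open>det\<close> and with matrix-vector
  products.\<close>

lemma fourier_coeff_comm_ring_hom:
  assumes j: "j < CARD('k)"
  shows "comm_ring_hom (fourier_coeff j :: 'k::finite circulant \<Rightarrow> complex)"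
proof
  let ?k = "CARD('k)"
  define w where "w = cnj (unity_root ?k) ^ j"
  note coeff = fourier_coeff_eq[OF j, folded w_def]
  have w: "w ^ ?k = 1"
    unfolding w_def
    by (metis cnj_unity_root_power_self mult.commute power_mult power_one zero_less_card_finite)
  show "fourier_coeff j (0 :: 'k circulant) = 0"
    by (simp add: coeff params_eq_index_circ circ_zero)
  have "fourier_coeff j (1 :: 'k circulant) = (\<Sum>l<?k. if l = 0 then w ^ l else 0)"
    unfolding coeff by (intro sum.cong refl) (simp add: params_eq_index_circ circ_one)
  then show "fourier_coeff j (1 :: 'k circulant) = 1" by simp
  fix \<alpha> \<beta> :: "'k circulant"
  show "fourier_coeff j (\<alpha> + \<beta>) = fourier_coeff j \<alpha> + fourier_coeff j \<beta>"
    by (simp add: coeff params_eq_index_circ circ_plus distrib_right sum.distrib)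
  have "fourier_coeff j (\<alpha> * \<beta>) =
      (\<Sum>m<?k. \<Sum>l<?k. (params \<alpha> $ ((m + ?k - l) mod ?k) * w ^ m) * params \<beta> $ l)"
    unfolding coeff
    by (intro sum.cong refl)
      (simp add: params_eq_index_circ circ_times circ_mult_shift sum_distrib_left sum_distrib_right mult_ac
        del: index_mult_mat)
  also have "\<dots> = (\<Sum>l<?k. (w ^ l * fourier_coeff j \<alpha>) * params \<beta> $ l)"
    using w by (subst sum.swap) (simp add: coeff sum_shift_mult_power flip: sum_distrib_right)
  also have "\<dots> = fourier_coeff j \<alpha> * fourier_coeff j \<beta>"
    by (simp add: coeff[of \<beta>] sum_distrib_left mult_ac)
  finally show "fourier_coeff j (\<alpha> * \<beta>) = fourier_coeff j \<alpha> * fourier_coeff j \<beta>" .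
qed

text \<open>After exchanging the sums, orthogonality keeps only the parameter at
  \<open>l\<close>.\<close>

lemma fourier_inversion:
  fixes \<alpha> :: "'k::finite circulant"
  assumes l: "l < CARD('k)"
  shows "(\<Sum>j<CARD('k). fourier_coeff j \<alpha> * unity_root CARD('k) ^ (l * j)) =
    of_nat CARD('k) * params \<alpha> $ l"
proof -
  let ?k = "CARD('k)" and ?u = "unity_root CARD('k)"
  have "(\<Sum>j<?k. fourier_coeff j \<alpha> * ?u ^ (l * j)) =
      (\<Sum>j<?k. \<Sum>m<?k. params \<alpha> $ m * (?u ^ l * cnj ?u ^ m) ^ j)"
    by (intro sum.cong refl)
      (simp add: fourier_coeff_eq sum_distrib_left sum_distrib_right power_mult_distrib mult_ac flip: power_mult)
  also have "\<dots> = (\<Sum>m<?k. if l = m then of_nat ?k * params \<alpha> $ l else 0)"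
    using l by (subst sum.swap, intro sum.cong refl)
      (simp add: unity_root_orthogonal flip: sum_distrib_left)
  finally show ?thesis using l by simp
qed

text \<open>Injectivity of the transform: inversion recovers the parameters from the
  coefficients.\<close>

lemma circulant_eqI:
  fixes \<alpha> \<beta> :: "'k::finite circulant"
  assumes "\<And>j. j < CARD('k) \<Longrightarrow> fourier_coeff j \<alpha> = fourier_coeff j \<beta>"
  shows "\<alpha> = \<beta>"
proof -
  have "params \<alpha> = params \<beta>"
  proof (rule eq_vecI)
    fix l assume "l < dim_vec (params \<beta>)"
    then have l: "l < CARD('k)" by simp
    have "of_nat CARD('k) * params \<alpha> $ l = of_nat CARD('k) * params \<beta> $ l"
      unfolding fourier_inversion[OF l, symmetric] using assms by simp
    then show "params \<alpha> $ l = params \<beta> $ l" by simp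
  qed simp
  then show ?thesis by (simp add: params_inject)
qed

text \<open>The argument is a function on \<open>nat\<close> of which only the values below
  \<open>CARD('k)\<close> enter, so a choice of one value per block can be passed directly.\<close>

definition inverse_fourier :: "(nat \<Rightarrow> complex) \<Rightarrow> 'k::finite circulant" where
  "inverse_fourier c = circulant_of (vec CARD('k)
    (\<lambda>l. (\<Sum>j<CARD('k). c j * unity_root CARD('k) ^ (l * j)) / of_nat CARD('k)))"

text \<open>Surjectivity of the transform: orthogonality again, now summing over the parameter
  index.\<close>

lemma fourier_coeff_inverse_fourier [simp]:
  assumes i: "i < CARD('k)"
  shows "fourier_coeff i (inverse_fourier c :: 'k::finite circulant) = c i"
proof -
  let ?k = "CARD('k)" and ?u = "unity_root CARD('k)"
  have "params (inverse_fourier c :: 'k circulant) =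
      vec ?k (\<lambda>l. (\<Sum>j<?k. c j * ?u ^ (l * j)) / of_nat ?k)"
    unfolding inverse_fourier_def by (rule circulant_of_inverse) simp
  then have "fourier_coeff i (inverse_fourier c :: 'k circulant) =
      (\<Sum>l<?k. (\<Sum>j<?k. c j * ?u ^ (l * j)) / of_nat ?k * (cnj ?u ^ i) ^ l)"
    using i by (simp add: fourier_coeff_eq)
  also have "\<dots> = (\<Sum>l<?k. \<Sum>j<?k. c j / of_nat ?k * (?u ^ j * cnj ?u ^ i) ^ l)"
    by (intro sum.cong refl)
      (simp add: sum_distrib_left sum_distrib_right sum_divide_distrib power_mult_distrib mult_ac flip: power_mult)
  also have "\<dots> = (\<Sum>j<?k. if j = i then c i else 0)"
    using i by (subst sum.swap, intro sum.cong refl)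
      (simp add: unity_root_orthogonal flip: sum_distrib_left sum_divide_distrib)
  finally show ?thesis using i by simp
qed

text \<open>Conjugation fixes real parameters and turns the powers for \<open>j\<close> into those
  for \<open>k - j\<close>. Index 0 is excluded because its mirror \<open>k\<close> lies out of
  range.\<close>

lemma fourier_coeff_mirror_real:
  fixes \<alpha> :: "'k::finite circulant"
  assumes "real_valued \<alpha>" "0 < j" "j < CARD('k)"
  shows "fourier_coeff (CARD('k) - j) \<alpha> = cnj (fourier_coeff j \<alpha>)"
proof -
  let ?k = "CARD('k)" and ?u = "unity_root CARD('k)"
  \<comment> \<open>Inserting this factor 1 completes the exponent of \<open>cnj ?u\<close> to
    \<open>?k\<close>.\<close>
  have "cnj ?u ^ (?k - j) = cnj ?u ^ (?k - j) * (?u ^ j * cnj ?u ^ j)" by simp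
  also have "\<dots> = ?u ^ j * cnj ?u ^ ?k"
    using assms(3) by (simp add: mult_ac del: unity_root_power_mult_cnj flip: power_add)
  finally have w: "cnj ?u ^ (?k - j) = ?u ^ j" by (simp add: cnj_unity_root_power_self)
  have "cnj (params \<alpha> $ l) = params \<alpha> $ l" if "l < ?k" for l
    using assms(1) that by (simp add: real_valued_def Reals_cnj_iff)
  then show ?thesis
    using assms(2,3) by (simp add: fourier_coeff_eq w)
qed


section \<open>Simple eigenvalues\<close>

text \<open>Dropping entry \<open>i\<close> of \<open>v\<close> gives the new eigenvector: column
  \<open>i\<close> contributes nothing to the product, and the entries left cannot all be 0.\<close>

lemma eigenvector_mat_delete:
  fixes M :: "'a::comm_ring_1 mat"
  assumes M: "M \<in> carrier_mat n n" and v: "eigenvector M v \<mu>" and i: "i < n" and vi: "v $ i = 0"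
  shows "eigenvalue (mat_delete M i i) \<mu>"
proof -
  define m where "m = n - 1"
  have n: "n = Suc m" using i by (simp add: m_def)
  have vn: "v \<in> carrier_vec n" "v \<noteq> 0\<^sub>v n" and Mv: "M *\<^sub>v v = \<mu> \<cdot>\<^sub>v v"
    using v M by (auto simp: eigenvector_def)
  \<comment> \<open>\<open>insert_index i\<close> enumerates the indices other than
    \<open>i\<close>.\<close>
  define w where "w = vec m (\<lambda>r. v $ insert_index i r)"
  have D: "mat_delete M i i \<in> carrier_mat m m"
    using mat_delete_carrier[OF M] by (simp add: m_def)
  have ins: "insert_index i r < n" if "r < m" for r
    using that n by (simp add: insert_index_def)
  have "w \<noteq> 0\<^sub>v m"
  proof
    assume w0: "w = 0\<^sub>v m"
    have "v = 0\<^sub>v n"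
    proof (rule eq_vecI)
      fix r assume "r < dim_vec (0\<^sub>v n)"
      then have r: "r < n" by simp
      show "v $ r = 0\<^sub>v n $ r"
      proof (cases "r = i")
        case False
        then have "r \<in> insert_index i ` {0..<m}"
          using r i by (simp add: insert_index_image n)
        then obtain s where s: "s < m" "r = insert_index i s" by auto
        then have "v $ r = w $ s" by (simp add: w_def)
        then show ?thesis using w0 s r by simp
      qed (use r vi in simp)
    qed (use vn in simp)
    then show False using vn by simp
  qed
  moreover have "mat_delete M i i *\<^sub>v w = \<mu> \<cdot>\<^sub>v w"
  proof (rule eq_vecI)
    fix r assume "r < dim_vec (\<mu> \<cdot>\<^sub>v w)"
    then have r: "r < m" by (simp add: w_def)
    have "(mat_delete M i i *\<^sub>v w) $ r =
        (\<Sum>s\<in>{0..<m}. M $$ (insert_index i r, insert_index i s) * v $ insert_index i s)"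
      using r D M i n
      by (simp add: scalar_prod_def w_def mat_delete_index[of M m i i])
    also have "\<dots> = (\<Sum>s\<in>insert_index i ` {0..<m}. M $$ (insert_index i r, s) * v $ s)"
      by (simp add: sum.reindex[OF insert_index_inj_on] o_def)
    also have "\<dots> = (\<Sum>s\<in>{0..<n}. M $$ (insert_index i r, s) * v $ s)"
      using i vi by (intro sum.mono_neutral_left) (auto simp: insert_index_image n)
    also have "\<dots> = (M *\<^sub>v v) $ insert_index i r"
      using M vn ins[OF r] by (simp add: scalar_prod_def)
    also have "\<dots> = (\<mu> \<cdot>\<^sub>v w) $ r"
      unfolding Mv using vn ins[OF r] r by (simp add: w_def)
    finally show "(mat_delete M i i *\<^sub>v w) $ r = (\<mu> \<cdot>\<^sub>v w) $ r" .
  qed (use M in \<open>simp add: w_def m_def\<close>)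
  ultimately have "eigenvector (mat_delete M i i) w \<mu>"
    using D by (auto simp: eigenvector_def w_def)
  then show ?thesis by (auto simp: eigenvalue_def)
qed

text \<open>
  The derivative of the characteristic polynomial is the sum of those of the principal minors, so
  at a simple root some principal minor \<open>i\<close> does not have \<open>\<mu>\<close> as an eigenvalue. Hence no
  eigenvector vanishes at \<open>i\<close>, and two of them are proportional with ratio \<open>w $ i / v $ i\<close>.
\<close>

lemma simple_eigenvalue_eigenvectors_proportional:
  fixes M :: "'a::field_char_0 mat"
  assumes M: "M \<in> carrier_mat n n" and ord: "order \<mu> (char_poly M) = 1"
    and v: "eigenvector M v \<mu>" and w: "eigenvector M w \<mu>"
  obtains c where "c \<noteq> 0" "w = c \<cdot>\<^sub>v v"
proof -
  let ?p = "char_poly M"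
  have vn: "v \<in> carrier_vec n" "w \<in> carrier_vec n" "v \<noteq> 0\<^sub>v n" "w \<noteq> 0\<^sub>v n"
    and Mv: "M *\<^sub>v v = \<mu> \<cdot>\<^sub>v v" "M *\<^sub>v w = \<mu> \<cdot>\<^sub>v w"
    using v w M by (auto simp: eigenvector_def)
  have p0: "?p \<noteq> 0" using degree_monic_char_poly[OF M] by auto
  moreover have root: "poly ?p \<mu> = 0"
    using v eigenvalue_root_char_poly[OF M] by (auto simp: eigenvalue_def)
  ultimately have "order \<mu> (pderiv ?p) = 0" using order_pderiv[of ?p \<mu>] ord by simp
  \<comment> \<open>In characteristic 0 a vanishing derivative would make \<open>?p\<close> a
    nonzero constant, which has no root.\<close>
  moreover have "pderiv ?p \<noteq> 0"
    using p0 root by (auto dest: pderiv_iszero)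
  ultimately have "poly (pderiv ?p) \<mu> \<noteq> 0" by (simp add: order_root)
  then have "(\<Sum>i<n. poly (char_poly (mat_delete M i i)) \<mu>) \<noteq> 0"
    by (simp add: pderiv_char_poly[OF M] poly_sum)
  then obtain i where i: "i < n" "poly (char_poly (mat_delete M i i)) \<mu> \<noteq> 0"
    by (meson lessThan_iff sum.not_neutral_contains_not_neutral)
  have ndel: "\<not> eigenvalue (mat_delete M i i) \<mu>"
    using i eigenvalue_root_char_poly[OF mat_delete_carrier[OF M]] by simp
  have nz: "x $ i \<noteq> 0" if "eigenvector M x \<mu>" for x
    using eigenvector_mat_delete[OF M that i(1)] ndel by blast
  define c where "c = w $ i / v $ i"
  \<comment> \<open>\<open>z\<close> satisfies the eigenvector equation but vanishes at
    \<open>i\<close>, so it can only be the zero vector.\<close>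
  define z where "z = w - c \<cdot>\<^sub>v v"
  have zn: "z \<in> carrier_vec n" using vn by (simp add: z_def)
  have "M *\<^sub>v z = \<mu> \<cdot>\<^sub>v w - c \<cdot>\<^sub>v (\<mu> \<cdot>\<^sub>v v)"
    unfolding z_def using M vn
    by (simp add: mult_minus_distrib_mat_vec mult_mat_vec Mv)
  also have "\<dots> = \<mu> \<cdot>\<^sub>v z"
    using vn by (intro eq_vecI) (auto simp: z_def algebra_simps)
  finally have "M *\<^sub>v z = \<mu> \<cdot>\<^sub>v z" .
  moreover have "z $ i = 0" using i vn nz[OF v] by (simp add: z_def c_def)
  ultimately have "z = 0\<^sub>v n"
    using nz[of z] zn M by (auto simp: eigenvector_def)
  have "w = c \<cdot>\<^sub>v v"
  proof (rule eq_vecI)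
    fix r assume "r < dim_vec (c \<cdot>\<^sub>v v)"
    then have r: "r < n" using vn by simp
    have "z $ r = 0" using \<open>z = 0\<^sub>v n\<close> r by simp
    then show "w $ r = (c \<cdot>\<^sub>v v) $ r" using r vn by (simp add: z_def)
  qed (use vn in simp)
  moreover have "c \<noteq> 0" using nz[OF v] nz[OF w] by (simp add: c_def)
  ultimately show ?thesis using that by blast
qed

section \<open>Eigenpairs of circulant matrices\<close>

lemma circulant_vec_eqI:
  fixes x y :: "'k::finite circulant vec"
  assumes "dim_vec x = dim_vec y"
    and "\<And>j. j < CARD('k) \<Longrightarrow> vec_block j x = vec_block j y"
  shows "x = y"
proof (rule eq_vecI)
  fix i assume i: "i < dim_vec y"
  show "x $ i = y $ i"
  proof (rule circulant_eqI)
    fix j assume "j < CARD('k)"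
    then have "vec_block j x $ i = vec_block j y $ i" by (simp add: assms(2))
    then show "fourier_coeff j (x $ i) = fourier_coeff j (y $ i)"
      using i assms(1) by (simp add: vec_block_def)
  qed
qed (rule assms(1))

lemma circulant_vec_of_blocks:
  assumes "\<And>j. j < CARD('k) \<Longrightarrow> c j \<in> carrier_vec n"
  obtains x :: "'k::finite circulant vec"
  where "x \<in> carrier_vec n" "\<And>j. j < CARD('k) \<Longrightarrow> vec_block j x = c j"
proof
  let ?x = "vec n (\<lambda>i. inverse_fourier (\<lambda>j. c j $ i)) :: 'k circulant vec"
  show "?x \<in> carrier_vec n" by simp
  show "vec_block j ?x = c j" if "j < CARD('k)" for j
    using assms[OF that] that by (intro eq_vecI) (auto simp: vec_block_def)
qed

text \<open>Inverting every coefficient gives the coefficients of the inverse.\<close>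

lemma circulant_dvd_1I:
  fixes u :: "'k::finite circulant"
  assumes "\<And>j. j < CARD('k) \<Longrightarrow> fourier_coeff j u \<noteq> 0"
  shows "u dvd 1"
proof
  show "1 = u * inverse_fourier (\<lambda>j. inverse (fourier_coeff j u))"
  proof (rule circulant_eqI)
    fix j assume j: "j < CARD('k)"
    interpret comm_ring_hom "fourier_coeff j :: 'k circulant \<Rightarrow> complex"
      by (rule fourier_coeff_comm_ring_hom[OF j])
    show "fourier_coeff j (1 :: 'k circulant) =
        fourier_coeff j (u * inverse_fourier (\<lambda>j. inverse (fourier_coeff j u)))"
      using assms[OF j] j by (simp add: hom_mult)
  qed
qed

text \<open>A ring homomorphism commutes with \<open>det\<close>, so coefficient \<open>j\<close> of
  the determinant is that of the characteristic matrix of block \<open>j\<close>; the determinant is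
  0 exactly if all its coefficients are.\<close>

lemma circ_eigenvalue_iff:
  fixes A :: "'k::finite circulant mat"
  assumes A: "A \<in> carrier_mat n n"
  shows "circ_eigenvalue A \<mu> \<longleftrightarrow>
    (\<forall>j<CARD('k). eigenvalue (mat_block j A) (fourier_coeff j \<mu>))"
proof -
  let ?B = "A - \<mu> \<cdot>\<^sub>m 1\<^sub>m n"
  have "fourier_coeff j (det ?B) = 0 \<longleftrightarrow> eigenvalue (mat_block j A) (fourier_coeff j \<mu>)"
    if j: "j < CARD('k)" for j
  proof -
    interpret comm_ring_hom "fourier_coeff j :: 'k circulant \<Rightarrow> complex"
      by (rule fourier_coeff_comm_ring_hom[OF j])
    have "map_mat (fourier_coeff j) ?B = char_matrix (mat_block j A) (fourier_coeff j \<mu>)"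
      using A by (intro eq_matI) (auto simp: char_matrix_def mat_block_def hom_minus)
    then have "fourier_coeff j (det ?B) = det (char_matrix (mat_block j A) (fourier_coeff j \<mu>))"
      by (simp flip: hom_det)
    then show ?thesis
      using eigenvalue_det[of "mat_block j A" n "fourier_coeff j \<mu>"] A by (simp add: mat_block_def)
  qed
  moreover have "det ?B = 0 \<longleftrightarrow> (\<forall>j<CARD('k). fourier_coeff j (det ?B) = 0)"
  proof
    have zero: "fourier_coeff j (0 :: 'k circulant) = 0" if j: "j < CARD('k)" for j
    proof -
      interpret comm_ring_hom "fourier_coeff j :: 'k circulant \<Rightarrow> complex"
        by (rule fourier_coeff_comm_ring_hom[OF j])
      show ?thesis by simp
    qed
    then show "det ?B = 0 \<Longrightarrow> \<forall>j<CARD('k). fourier_coeff j (det ?B) = 0" by simp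
    show "\<forall>j<CARD('k). fourier_coeff j (det ?B) = 0 \<Longrightarrow> det ?B = 0"
      by (rule circulant_eqI) (simp add: zero)
  qed
  ultimately show ?thesis using A by (auto simp: circ_eigenvalue_def)
qed

lemma vec_block_smult:
  assumes "j < CARD('k)"
  shows "vec_block j (u \<cdot>\<^sub>v x :: 'k::finite circulant vec) = fourier_coeff j u \<cdot>\<^sub>v vec_block j x"
proof -
  interpret comm_ring_hom "fourier_coeff j :: 'k circulant \<Rightarrow> complex"
    by (rule fourier_coeff_comm_ring_hom[OF assms])
  show ?thesis by (simp add: vec_block_def vec_hom_smult)
qed

lemma vec_block_mult_mat_vec:
  fixes A :: "'k::finite circulant mat"
  assumes "j < CARD('k)" "A \<in> carrier_mat m n" "x \<in> carrier_vec n"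
  shows "vec_block j (A *\<^sub>v x) = mat_block j A *\<^sub>v vec_block j x"
proof -
  interpret comm_ring_hom "fourier_coeff j :: 'k circulant \<Rightarrow> complex"
    by (rule fourier_coeff_comm_ring_hom[OF assms(1)])
  show ?thesis using assms by (simp add: vec_block_def mat_block_def mult_mat_vec_hom)
qed

section \<open>Eigenvectors belonging to a given eigenvalue\<close>

text \<open>When the blocks have simple eigenvalues, these sets, for eigenvalues \<mu>, turn out to
  be the normalization classes.\<close>

definition circ_eigenvectors_for ::
    "'k::finite circulant mat \<Rightarrow> 'k circulant \<Rightarrow> 'k circulant vec set" where
  "circ_eigenvectors_for A \<mu> = {x. x \<in> carrier_vec (dim_row A) \<and>
    (\<forall>j < CARD('k). vec_block j x \<noteq> 0\<^sub>v (dim_row A)) \<and> A *\<^sub>v x = \<mu> \<cdot>\<^sub>v x}"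

lemma circ_eigenvector_iff:
  "circ_eigenvector A x \<longleftrightarrow> (\<exists>\<mu>. circ_eigenvalue A \<mu> \<and> x \<in> circ_eigenvectors_for A \<mu>)"
  unfolding circ_eigenvector_def circ_eigenvectors_for_def by blast

lemma circ_eigenvectors_for_iff:
  fixes A :: "'k::finite circulant mat"
  assumes A: "A \<in> carrier_mat n n"
  shows "x \<in> circ_eigenvectors_for A \<mu> \<longleftrightarrow> x \<in> carrier_vec n \<and>
    (\<forall>j<CARD('k). eigenvector (mat_block j A) (vec_block j x) (fourier_coeff j \<mu>))"
proof (cases "x \<in> carrier_vec n")
  case True
  have "A *\<^sub>v x = \<mu> \<cdot>\<^sub>v x \<longleftrightarrow>
      (\<forall>j<CARD('k). vec_block j (A *\<^sub>v x) = vec_block j (\<mu> \<cdot>\<^sub>v x))"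
    using A True by (auto intro: circulant_vec_eqI)
  then have "A *\<^sub>v x = \<mu> \<cdot>\<^sub>v x \<longleftrightarrow>
      (\<forall>j<CARD('k). mat_block j A *\<^sub>v vec_block j x = fourier_coeff j \<mu> \<cdot>\<^sub>v vec_block j x)"
    using A True by (simp add: vec_block_smult vec_block_mult_mat_vec)
  moreover have "vec_block j x \<in> carrier_vec n" for j
    using True by (simp add: vec_block_def)
  ultimately show ?thesis
    using A True by (auto simp: circ_eigenvectors_for_def eigenvector_def mat_block_def)
qed (use A in \<open>simp add: circ_eigenvectors_for_def\<close>)

text \<open>Eigenvectors chosen block by block assemble into one vector over the ring.\<close>

lemma circ_eigenvectors_for_nonempty:
  fixes A :: "'k::finite circulant mat"
  assumes A: "A \<in> carrier_mat n n" and \<mu>: "circ_eigenvalue A \<mu>"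
  shows "circ_eigenvectors_for A \<mu> \<noteq> {}"
proof -
  from \<mu> obtain c where c:
    "\<And>j. j < CARD('k) \<Longrightarrow> eigenvector (mat_block j A) (c j) (fourier_coeff j \<mu>)"
    unfolding circ_eigenvalue_iff[OF A] eigenvalue_def by metis
  have cn: "c j \<in> carrier_vec n" if "j < CARD('k)" for j
    using c[OF that] A by (simp add: eigenvector_def mat_block_def)
  obtain x :: "'k circulant vec"
    where "x \<in> carrier_vec n" "\<And>j. j < CARD('k) \<Longrightarrow> vec_block j x = c j"
    using circulant_vec_of_blocks[of c n, OF cn] by blast
  then have "x \<in> circ_eigenvectors_for A \<mu>"
    using c by (simp add: circ_eigenvectors_for_iff[OF A])
  then show ?thesis by blast
qed

text \<open>Every block of \<open>x\<close> has a nonzero entry, at which the corresponding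
  coefficient of the eigenvalue can be read off.\<close>

lemma circ_eigenvectors_for_unique:
  fixes A :: "'k::finite circulant mat"
  assumes A: "A \<in> carrier_mat n n"
    and x: "x \<in> circ_eigenvectors_for A \<mu>" "x \<in> circ_eigenvectors_for A \<nu>"
  shows "\<mu> = \<nu>"
proof (rule circulant_eqI)
  fix j assume j: "j < CARD('k)"
  let ?v = "vec_block j x"
  have v: "?v \<in> carrier_vec n" "?v \<noteq> 0\<^sub>v n"
    and eq: "fourier_coeff j \<mu> \<cdot>\<^sub>v ?v = fourier_coeff j \<nu> \<cdot>\<^sub>v ?v"
    using x j A by (auto simp: circ_eigenvectors_for_iff[OF A] eigenvector_def mat_block_def)
  from v obtain i where i: "i < n" "?v $ i \<noteq> 0"
    by (metis carrier_vecD eq_vecI index_zero_vec)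
  have "(fourier_coeff j \<mu> \<cdot>\<^sub>v ?v) $ i = (fourier_coeff j \<nu> \<cdot>\<^sub>v ?v) $ i" by (simp only: eq)
  then show "fourier_coeff j \<mu> = fourier_coeff j \<nu>" using i v by simp
qed

text \<open>Scaling preserves the eigenvector equation because the ring is commutative; that no
  block vanishes is taken from \<open>ux\<close>.\<close>

lemma circ_eigenvectors_for_smult:
  fixes A :: "'k::finite circulant mat"
  assumes A: "A \<in> carrier_mat n n" and x: "x \<in> circ_eigenvectors_for A \<mu>"
    and ux: "circ_eigenvector A (u \<cdot>\<^sub>v x)"
  shows "u \<cdot>\<^sub>v x \<in> circ_eigenvectors_for A \<mu>"
proof -
  have xn: "x \<in> carrier_vec n" and "A *\<^sub>v x = \<mu> \<cdot>\<^sub>v x"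
    using x A by (auto simp: circ_eigenvectors_for_def)
  then have "A *\<^sub>v (u \<cdot>\<^sub>v x) = \<mu> \<cdot>\<^sub>v (u \<cdot>\<^sub>v x)"
  proof -
    have "A *\<^sub>v (u \<cdot>\<^sub>v x) = u \<cdot>\<^sub>v (A *\<^sub>v x)"
      using A xn by (intro eq_vecI) auto
    then show ?thesis
      using \<open>A *\<^sub>v x = \<mu> \<cdot>\<^sub>v x\<close> by (simp add: smult_smult_assoc mult.commute)
  qed
  then show ?thesis
    using ux by (auto simp: circ_eigenvector_def circ_eigenvectors_for_def)
qed

text \<open>Simplicity gives one nonzero ratio per block; these are the coefficients of a single
  ring element, which is therefore a unit.\<close>

lemma circ_eigenvectors_for_proportional:
  fixes A :: "'k::finite circulant mat"
  assumes A: "A \<in> carrier_mat n n"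
    and simple: "\<And>j. j < CARD('k) \<Longrightarrow> has_simple_eigenvalues (mat_block j A)"
    and x: "x \<in> circ_eigenvectors_for A \<mu>" and y: "y \<in> circ_eigenvectors_for A \<mu>"
  shows "\<exists>u. u dvd 1 \<and> y = u \<cdot>\<^sub>v x"
proof -
  have "\<exists>c. c \<noteq> 0 \<and> vec_block j y = c \<cdot>\<^sub>v vec_block j x" if j: "j < CARD('k)" for j
  proof -
    have ev: "eigenvector (mat_block j A) (vec_block j x) (fourier_coeff j \<mu>)"
      "eigenvector (mat_block j A) (vec_block j y) (fourier_coeff j \<mu>)"
      using x y j by (simp_all add: circ_eigenvectors_for_iff[OF A])
    then have "order (fourier_coeff j \<mu>) (char_poly (mat_block j A)) = 1"
      using simple[OF j] by (auto simp: has_simple_eigenvalues_def eigenvalue_def)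
    then show ?thesis
      using simple_eigenvalue_eigenvectors_proportional[OF _ _ ev, of n] A
      by (metis mat_block_def map_carrier_mat)
  qed
  then obtain c where c:
    "\<And>j. j < CARD('k) \<Longrightarrow> c j \<noteq> 0 \<and> vec_block j y = c j \<cdot>\<^sub>v vec_block j x" by metis
  let ?u = "inverse_fourier c :: 'k circulant"
  have "?u dvd 1" by (rule circulant_dvd_1I) (simp add: c)
  moreover have "y = ?u \<cdot>\<^sub>v x"
    using x y by (intro circulant_vec_eqI)
      (auto simp: circ_eigenvectors_for_def vec_block_smult c)
  ultimately show ?thesis by blast
qed

lemma quotient_same_up_to_normalization:
  fixes A :: "'k::finite circulant mat"
  assumes A: "A \<in> carrier_mat n n"
    and simple: "\<And>j. j < CARD('k) \<Longrightarrow> has_simple_eigenvalues (mat_block j A)"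
  shows "{x. circ_eigenvector A x} // same_up_to_normalization A =
    circ_eigenvectors_for A ` {\<mu>. circ_eigenvalue A \<mu>}"
proof -
  \<comment> \<open>Scaling keeps the eigenvalue, which gives one inclusion; proportionality of
    eigenvectors gives the other.\<close>
  have cls: "same_up_to_normalization A `` {x} = circ_eigenvectors_for A \<mu>"
    if \<mu>: "circ_eigenvalue A \<mu>" and x: "x \<in> circ_eigenvectors_for A \<mu>" for x \<mu>
  proof -
    have ev: "circ_eigenvector A y" if "y \<in> circ_eigenvectors_for A \<mu>" for y
      using \<mu> that by (auto simp: circ_eigenvector_iff)
    show ?thesis
      using x circ_eigenvectors_for_smult[OF A x]
        circ_eigenvectors_for_proportional[OF A simple x]
      by (auto simp: same_up_to_normalization_def intro!: ev)
  qed
  show ?thesis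
  proof (intro equalityI subsetI)
    fix Q assume "Q \<in> {x. circ_eigenvector A x} // same_up_to_normalization A"
    then obtain x where "circ_eigenvector A x" and Q: "Q = same_up_to_normalization A `` {x}"
      by (auto elim: quotientE)
    then show "Q \<in> circ_eigenvectors_for A ` {\<mu>. circ_eigenvalue A \<mu>}"
      using cls by (auto simp: circ_eigenvector_iff)
  next
    fix Q assume "Q \<in> circ_eigenvectors_for A ` {\<mu>. circ_eigenvalue A \<mu>}"
    then obtain \<mu> where \<mu>: "circ_eigenvalue A \<mu>" and Q: "Q = circ_eigenvectors_for A \<mu>" by blast
    obtain x where x: "x \<in> circ_eigenvectors_for A \<mu>"
      using circ_eigenvectors_for_nonempty[OF A \<mu>] by blast
    then have "circ_eigenvector A x" using \<mu> by (auto simp: circ_eigenvector_iff)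
    then show "Q \<in> {x. circ_eigenvector A x} // same_up_to_normalization A"
      unfolding Q cls[OF \<mu> x, symmetric] by (simp add: quotientI)
  qed
qed

section \<open>Counting eigenvalues\<close>

lemma bij_betw_circ_eigenvalues:
  fixes A :: "'k::finite circulant mat"
  assumes A: "A \<in> carrier_mat n n"
  shows "bij_betw (\<lambda>\<mu>. \<lambda>j\<in>{..<CARD('k)}. fourier_coeff j \<mu>) {\<mu>. circ_eigenvalue A \<mu>}
    (\<Pi>\<^sub>E j\<in>{..<CARD('k)}. spectrum (mat_block j A))"
proof (rule bij_betw_byWitness[where f' = inverse_fourier])
  show "\<forall>\<mu>\<in>{\<mu>. circ_eigenvalue A \<mu>}.
      inverse_fourier (\<lambda>j\<in>{..<CARD('k)}. fourier_coeff j \<mu>) = \<mu>"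
    by (auto intro!: circulant_eqI)
  \<comment> \<open>Outside \<open>{..<CARD('k)}\<close> both functions are
    \<open>undefined\<close>, by extensionality of \<open>c\<close>.\<close>
  show "\<forall>c\<in>\<Pi>\<^sub>E j\<in>{..<CARD('k)}. spectrum (mat_block j A).
      (\<lambda>j\<in>{..<CARD('k)}. fourier_coeff j (inverse_fourier c :: 'k circulant)) = c"
    by (auto simp: PiE_iff extensional_def restrict_def fun_eq_iff)
  show "(\<lambda>\<mu>. \<lambda>j\<in>{..<CARD('k)}. fourier_coeff j \<mu>) ` {\<mu>. circ_eigenvalue A \<mu>}
      \<subseteq> (\<Pi>\<^sub>E j\<in>{..<CARD('k)}. spectrum (mat_block j A))"
    by (auto simp: circ_eigenvalue_iff[OF A] spectrum_def PiE_iff split: if_splits)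
  show "inverse_fourier ` (\<Pi>\<^sub>E j\<in>{..<CARD('k)}. spectrum (mat_block j A))
      \<subseteq> {\<mu>. circ_eigenvalue A \<mu>}"
  proof clarify
    fix c assume c: "c \<in> (\<Pi>\<^sub>E j\<in>{..<CARD('k)}. spectrum (mat_block j A))"
    have "eigenvalue (mat_block j A) (c j)" if "j < CARD('k)" for j
      using PiE_mem[OF c, of j] that by (simp add: spectrum_def)
    then show "circ_eigenvalue A (inverse_fourier c)"
      by (simp add: circ_eigenvalue_iff[OF A])
  qed
qed

lemma circ_eigenvalues_finite_card:
  fixes A :: "'k::finite circulant mat"
  assumes A: "A \<in> carrier_mat n n"
  shows "finite {\<mu>. circ_eigenvalue A \<mu>}"
    and "card {\<mu>. circ_eigenvalue A \<mu>} = (\<Prod>j<CARD('k). card (spectrum (mat_block j A)))"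
proof -
  have "finite (spectrum (mat_block j A))" for j
    using A card_finite_spectrum[of "mat_block j A" n] by (simp add: mat_block_def)
  then show "finite {\<mu>. circ_eigenvalue A \<mu>}"
    using bij_betw_finite[OF bij_betw_circ_eigenvalues[OF A]] by (simp add: finite_PiE)
  show "card {\<mu>. circ_eigenvalue A \<mu>} = (\<Prod>j<CARD('k). card (spectrum (mat_block j A)))"
    using bij_betw_same_card[OF bij_betw_circ_eigenvalues[OF A]] by (simp add: card_PiE)
qed

text \<open>An index above \<open>k div 2\<close> is the mirror of one at most
  \<open>k div 2\<close>, so its coefficient is the conjugate of one already known.\<close>

lemma real_valued_eqI:
  fixes \<alpha> \<beta> :: "'k::finite circulant"
  assumes real: "real_valued \<alpha>" "real_valued \<beta>"
    and eq: "\<And>j. j \<le> CARD('k) div 2 \<Longrightarrow> fourier_coeff j \<alpha> = fourier_coeff j \<beta>"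
  shows "\<alpha> = \<beta>"
proof (rule circulant_eqI)
  fix j assume j: "j < CARD('k)"
  show "fourier_coeff j \<alpha> = fourier_coeff j \<beta>"
  proof (cases "j \<le> CARD('k) div 2")
    case False
    let ?i = "CARD('k) - j"
    have i: "0 < ?i" "?i < CARD('k)" "?i \<le> CARD('k) div 2" "CARD('k) - ?i = j"
      using j False by auto
    show ?thesis
      using fourier_coeff_mirror_real[OF real(1) i(1,2)] fourier_coeff_mirror_real[OF real(2) i(1,2)]
        eq[OF i(3)] i(4) by simp
  qed (rule eq)
qed

text \<open>Recording the coefficients at \<open>0, ..., k div 2\<close> is injective on real-valued
  eigenvalues, and each of these \<open>Suc (k div 2)\<close> coefficients has at most
  \<open>n\<close> possible values.\<close>

lemma card_real_valued_circ_eigenvalues_le: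
  fixes A :: "'k::finite circulant mat"
  assumes A: "A \<in> carrier_mat n n"
  shows "card {\<mu>. circ_eigenvalue A \<mu> \<and> real_valued \<mu>} \<le> n ^ Suc (CARD('k) div 2)"
proof -
  let ?h = "CARD('k) div 2"
  let ?f = "\<lambda>\<mu> :: 'k circulant. \<lambda>j\<in>{..?h}. fourier_coeff j \<mu>"
  let ?P = "\<Pi>\<^sub>E j\<in>{..?h}. spectrum (mat_block j A)"
  \<comment> \<open>Since \<open>k\<close> is positive, \<open>k div 2 < k\<close>, so all recorded
    indices are genuine block indices.\<close>
  have h: "j < CARD('k)" if "j \<le> ?h" for j
    using that by (rule le_less_trans) simp
  have spec: "finite (spectrum (mat_block j A))" "card (spectrum (mat_block j A)) \<le> n" for j
    using A card_finite_spectrum[of "mat_block j A" n] by (simp_all add: mat_block_def)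
  have "card {\<mu>. circ_eigenvalue A \<mu> \<and> real_valued \<mu>} \<le> card ?P"
  proof (rule card_inj_on_le)
    show "inj_on ?f {\<mu>. circ_eigenvalue A \<mu> \<and> real_valued \<mu>}"
    proof (rule inj_onI)
      fix \<mu> \<nu>
      assume "\<mu> \<in> {\<mu>. circ_eigenvalue A \<mu> \<and> real_valued \<mu>}"
        "\<nu> \<in> {\<mu>. circ_eigenvalue A \<mu> \<and> real_valued \<mu>}" and eq: "?f \<mu> = ?f \<nu>"
      then have "real_valued \<mu>" "real_valued \<nu>" by auto
      then show "\<mu> = \<nu>"
      proof (rule real_valued_eqI)
        fix j assume "j \<le> ?h"
        then show "fourier_coeff j \<mu> = fourier_coeff j \<nu>" using fun_cong[OF eq, of j] by simp
      qed
    qed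
    show "?f ` {\<mu>. circ_eigenvalue A \<mu> \<and> real_valued \<mu>} \<subseteq> ?P"
      using h by (auto simp: circ_eigenvalue_iff[OF A] spectrum_def PiE_iff split: if_splits)
    show "finite ?P" by (intro finite_PiE finite_atMost spec)
  qed
  also have "card ?P = (\<Prod>j\<le>?h. card (spectrum (mat_block j A)))" by (simp add: card_PiE)
  also have "\<dots> \<le> (\<Prod>j\<le>?h. n)" by (intro prod_mono) (simp add: spec)
  finally show ?thesis by simp
qed

theorem mainTheorem3:
  fixes A :: "'k::finite circulant mat" and n :: nat
  assumes "A \<in> carrier_mat n n"
    and "\<And>j. j < CARD('k) \<Longrightarrow> has_simple_eigenvalues (mat_block j A)"
  shows "finite {\<mu>. circ_eigenvalue A \<mu>}
    \<and> card {\<mu>. circ_eigenvalue A \<mu>} = (\<Prod>j<CARD('k). card (spectrum (mat_block j A)))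
    \<and> finite ({x. circ_eigenvector A x} // same_up_to_normalization A)
    \<and> card ({x. circ_eigenvector A x} // same_up_to_normalization A)
        = (\<Prod>j<CARD('k). card (spectrum (mat_block j A)))
    \<and> card {\<mu>. circ_eigenvalue A \<mu>} \<le> n ^ CARD('k)
    \<and> (real_valued_mat A \<longrightarrow>
        card {\<mu>. circ_eigenvalue A \<mu> \<and> real_valued \<mu>}
          \<le> n ^ nat \<lceil>(real CARD('k) + 1) / 2\<rceil>)"
proof (intro conjI impI)
  note A = assms(1)
  note fin = circ_eigenvalues_finite_card(1)[OF A]
  note card = circ_eigenvalues_finite_card(2)[OF A]
  note quot = quotient_same_up_to_normalization[OF assms]
  show "finite {\<mu>. circ_eigenvalue A \<mu>}" by (rule fin)
  show "card {\<mu>. circ_eigenvalue A \<mu>} = (\<Prod>j<CARD('k). card (spectrum (mat_block j A)))"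
    by (rule card)
  show "finite ({x. circ_eigenvector A x} // same_up_to_normalization A)"
    using fin by (simp add: quot)
  \<comment> \<open>Equal classes share a member, and that member determines its eigenvalue; so
    classes and eigenvalues are equally many.\<close>
  have "inj_on (circ_eigenvectors_for A) {\<mu>. circ_eigenvalue A \<mu>}"
    using circ_eigenvectors_for_nonempty[OF A] circ_eigenvectors_for_unique[OF A]
    by (intro inj_onI) blast
  then show "card ({x. circ_eigenvector A x} // same_up_to_normalization A)
      = (\<Prod>j<CARD('k). card (spectrum (mat_block j A)))"
    by (simp add: quot card_image card)
  have "card (spectrum (mat_block j A)) \<le> n" for j
    using A card_finite_spectrum[of "mat_block j A" n] by (simp add: mat_block_def)
  then have "(\<Prod>j<CARD('k). card (spectrum (mat_block j A))) \<le> (\<Prod>j<CARD('k). n)"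
    by (intro prod_mono) simp
  then show "card {\<mu>. circ_eigenvalue A \<mu>} \<le> n ^ CARD('k)" by (simp add: card)
  \<comment> \<open>For \<open>m = 2 * l\<close> and for \<open>m = 2 * l + 1\<close> both sides are
    \<open>l + 1\<close>.\<close>
  have "\<lceil>(real m + 1) / 2\<rceil> = int (Suc (m div 2))" for m
  proof (cases "even m")
    case True
    then obtain l where "m = 2 * l" by blast
    then show ?thesis by (simp add: ceiling_eq_iff)
  next
    case False
    then obtain l where "m = 2 * l + 1" by (elim oddE)
    then show ?thesis by (simp add: ceiling_eq_iff)
  qed
  then have "nat \<lceil>(real CARD('k) + 1) / 2\<rceil> = Suc (CARD('k) div 2)" by (simp only: nat_int)
  then show "card {\<mu>. circ_eigenvalue A \<mu> \<and> real_valued \<mu>}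
      \<le> n ^ nat \<lceil>(real CARD('k) + 1) / 2\<rceil>"
    using card_real_valued_circ_eigenvalues_le[OF A] by simp
qed

end
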